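(* Let $-2\pi<\theta<2\pi$, $\theta\neq0$, and $(x,v)\in\Gamma_\theta$. Then $\frac{1}{2}d_H((0,1),(x,v))^2=\Lambda(x,\theta)$. In addition, if $\theta=0$ and $(x,v)\in\Gamma_0$, then $x=0$ and $\frac{1}{2}d_H((0,1),(0,v))^2=2(\sqrt v-1)^2$.
   Context: Let $\mathcal{H}=\{(x,v)\in\mathbb{R}^2:v\ge0\}$ and let $d_H$ be the Riemannian distance on $\mathcal{H}$ induced by the metric $ds^2=v^{-1}(dx^2+dv^2)$ on the open upper half-plane (extended to the boundary). For $v\ge0$ and $0<|\delta|<2\pi$ set $$f(v,\delta)=\frac{(v+1)(\delta-\sin\delta)+2\sqrt v\,(2\sin\frac{\delta}{2}-\delta\cos\frac{\delta}{2})}{2\sin^2\frac{\delta}{2}},$$ and $f(v,0)=0$. For $(x,v)\in\mathcal{H}$, $\delta(x,v)$ denotes the unique $\delta\in(-2\pi,2\pi)$ with $f(v,\delta)=x$. For $-2\pi<\theta<2\pi$, $\Gamma_\theta=\{(x,v)\in\mathcal{H}:\delta(x,v)=\theta\}$. For $\theta\ne0$ and admissible $x$ (the expression under the root nonnegative), $$\Lambda(x,\theta)=\frac{\theta^2}{(\theta-\sin\theta)^2}\Big[(\theta-\sin\theta)x+2(1-\cos\theta)-\theta\sin\theta-(1-\cos\theta)\sqrt{2(\theta-\sin\theta)x+2(1-\cos\theta)-\theta^2}\Big],$$ with the nonnegative square root. *)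

theory Defs
  imports "HOL-Analysis.Analysis"
begin

definition Hplane :: "(real \<times> real) set" where
  "Hplane = {p. snd p \<ge> 0}"

text \<open>Length density of the metric v^{-1}(dx^2+dv^2) at position p with velocity w.
  On the boundary v = 0 a nonzero velocity has infinite cost.\<close>
definition speedH :: "real \<times> real \<Rightarrow> real \<times> real \<Rightarrow> ennreal" where
  "speedH p w = (if snd p > 0 then ennreal (norm w / sqrt (snd p))
                 else if w = 0 then 0 else \<infinity>)"

definition lengthH :: "(real \<Rightarrow> real \<times> real) \<Rightarrow> ennreal" where
  "lengthH g = (\<integral>\<^sup>+ t \<in> {0..1}. speedH (g t) (vector_derivative g (at t)) \<partial>lborel)"

definition dH :: "real \<times> real \<Rightarrow> real \<times> real \<Rightarrow> real" where
  "dH p q = enn2real (INF g \<in> {g. valid_path g \<and> path_image g \<subseteq> Hplane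
                                  \<and> pathstart g = p \<and> pathfinish g = q}. lengthH g)"

definition fH :: "real \<Rightarrow> real \<Rightarrow> real" where
  "fH v \<delta> = (if \<delta> = 0 then 0 else
     ((v + 1) * (\<delta> - sin \<delta>) + 2 * sqrt v * (2 * sin (\<delta>/2) - \<delta> * cos (\<delta>/2)))
       / (2 * (sin (\<delta>/2))^2))"

definition deltaH :: "real \<Rightarrow> real \<Rightarrow> real" where
  "deltaH x v = (THE \<delta>. -2*pi < \<delta> \<and> \<delta> < 2*pi \<and> fH v \<delta> = x)"

definition GammaH :: "real \<Rightarrow> (real \<times> real) set" where
  "GammaH \<theta> = {(x, v). (x, v) \<in> Hplane \<and> deltaH x v = \<theta>}"

definition LambdaH :: "real \<Rightarrow> real \<Rightarrow> real" where
  "LambdaH x \<theta> = \<theta>^2 / (\<theta> - sin \<theta>)^2 *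
     ((\<theta> - sin \<theta>) * x + 2 * (1 - cos \<theta>) - \<theta> * sin \<theta>
      - (1 - cos \<theta>) * sqrt (2 * (\<theta> - sin \<theta>) * x + 2 * (1 - cos \<theta>) - \<theta>^2))"

end

theory Submission
  imports Defs "HOL-Real_Asymp.Real_Asymp"
begin

text \<open>
  Put \<open>v = r\<^sup>2\<close> and \<open>\<omega> = \<theta>/2\<close>. The metric becomes \<open>dx\<^sup>2 / r\<^sup>2 + 4 dr\<^sup>2\<close>, and
  \<open>(x'/r - 2\<omega>r)\<^sup>2 \<ge> 0\<close> bounds the energy of a path on \<open>[0,1]\<close> from below by
  \<open>4\<omega>x + 4 \<integral> (r'\<^sup>2 - \<omega>\<^sup>2 r\<^sup>2)\<close>, a harmonic oscillator action. For \<open>\<bar>\<omega>\<bar> < \<pi>\<close> there is no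
  conjugate point, so the action is minimised by the solution of \<open>r'' = -\<omega>\<^sup>2 r\<close> with the given end
  values. Every \<open>\<omega>\<close> yields a lower bound for the squared distance; the one with
  \<open>f(v, 2\<omega>) = x\<close> is attained, because then the curve with \<open>x' = 2\<omega>r\<^sup>2\<close> (a cycloid, of constant
  speed) ends at \<open>(x, v)\<close>.

  The lower bound is proved for lengths rather than energies by the time-dependent calibration
  \<open>4\<omega>x + 4m(\<tau>)v\<close>, where \<open>m = r'/r\<close> solves the Riccati equation \<open>m' = -(\<omega>\<^sup>2 + m\<^sup>2)\<close> and \<open>\<tau>\<close> is the
  normalised arc length of the competing path.
\<close>

section \<open>The calibration inequality\<close>

lemma indefinite_integral_has_real_derivative_at:
  fixes f :: "real \<Rightarrow> real"
  assumes "f integrable_on {a..b}" "a < t" "t < b" "isCont f t"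
  shows "((\<lambda>u. integral {a..u} f) has_real_derivative f t) (at t)"
proof -
  have "((\<lambda>u. integral {a..u} f) has_vector_derivative f t) (at t within ({a..b} - {}))"
    by (rule integral_has_vector_derivative_continuous_at)
       (use assms in \<open>auto intro: continuous_at_imp_continuous_at_within\<close>)
  then show ?thesis
    using assms by (simp add: has_real_derivative_iff_has_vector_derivative at_within_Icc_at)
qed

text \<open>The finite set \<open>S\<close> stands for the breakpoints of a piecewise C1 path. The
  fundamental theorem of calculus tolerates them and gives \<open>h b - h a\<close> as the integral
  of a nonnegative function.\<close>

lemma nonneg_derivative_imp_le:
  fixes h :: "real \<Rightarrow> real"
  assumes "finite S" "a \<le> b" "continuous_on {a..b} h"
    and deriv: "\<And>t. t \<in> {a<..<b} - S \<Longrightarrow> \<exists>D\<ge>0. (h has_real_derivative D) (at t)"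
  shows "h a \<le> h b"
proof -
  obtain D where D: "\<And>t. t \<in> {a<..<b} - S \<Longrightarrow> D t \<ge> 0 \<and> (h has_real_derivative D t) (at t)"
    using deriv by metis
  define D' where "D' t = (if t \<in> {a<..<b} - S then D t else 0)" for t
  have "(D' has_integral (h b - h a)) {a..b}"
    by (rule fundamental_theorem_of_calculus_interior_strong[OF assms(1,2) _ assms(3)])
       (use D in \<open>auto simp: D'_def has_real_derivative_iff_has_vector_derivative\<close>)
  then have "0 \<le> h b - h a"
    by (rule has_integral_nonneg) (use D in \<open>auto simp: D'_def\<close>)
  then show ?thesis by simp
qed


text \<open>The left side is the derivative of the calibration along a path with velocity
  \<open>(a, b)\<close> when \<open>\<tau>\<close> grows at rate \<open>u\<close> and
  \<open>m\<close> solves the Riccati equation. Cauchy-Schwarz bounds the linear part, and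
  completing the square removes \<open>v\<close>.\<close>

lemma calibration_pointwise:
  fixes \<omega> m v K u a b :: real
  assumes v: "v > 0" and u: "u \<ge> 0" and ab: "norm (a, b) \<le> sqrt v * (K * u)"
  shows "4 * \<omega> * a + 4 * m * b - 4 * (\<omega>\<^sup>2 + m\<^sup>2) * v * u \<le> K\<^sup>2 * u"
proof -
  define q where "q = sqrt (\<omega>\<^sup>2 + m\<^sup>2)"
  have q: "q \<ge> 0" "q\<^sup>2 = \<omega>\<^sup>2 + m\<^sup>2" by (auto simp: q_def)
  have "\<omega> * a + m * b = (\<omega>, m) \<bullet> (a, b)" by (simp add: inner_Pair)
  also have "\<dots> \<le> norm (\<omega>, m) * norm (a, b)" by (rule norm_cauchy_schwarz)
  also have "\<dots> \<le> q * (sqrt v * (K * u))"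
    unfolding norm_Pair q_def using ab by (intro mult_mono) (auto simp: norm_Pair)
  finally have "4 * (\<omega> * a + m * b) \<le> 4 * q * sqrt v * K * u" by simp
  moreover have "0 \<le> (2 * q * sqrt v - K)\<^sup>2 * u" using u by simp
  moreover have "(2 * q * sqrt v - K)\<^sup>2 * u = 4 * (\<omega>\<^sup>2 + m\<^sup>2) * v * u + K\<^sup>2 * u - 4 * q * sqrt v * K * u"
    using v by (simp add: power2_diff power_mult_distrib q algebra_simps)
  ultimately show ?thesis by (simp add: algebra_simps)
qed

text \<open>The function \<open>h\<close>, which is \<open>K\<^sup>2 * \<tau>\<close> minus the
  calibration, is nondecreasing by \<open>calibration_pointwise\<close>. Comparing its values at 0
  and 1 gives the claim, since \<open>\<tau>\<close> runs from 0 to 1.\<close>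

lemma length_calibration:
  fixes g :: "real \<Rightarrow> real \<times> real" and m :: "real \<Rightarrow> real" and \<omega> K :: real
  assumes valid: "valid_path g" and pos: "\<And>t. t \<in> {0..1} \<Longrightarrow> snd (g t) > 0"
    and m: "\<And>\<tau>. \<tau> \<in> {0..1} \<Longrightarrow> (m has_real_derivative - (\<omega>\<^sup>2 + (m \<tau>)\<^sup>2)) (at \<tau>)"
    and len: "lengthH g < ennreal K"
  shows "4 * \<omega> * (fst (g 1) - fst (g 0)) + 4 * (m 1 * snd (g 1) - m 0 * snd (g 0)) \<le> K\<^sup>2"
proof -
  have K: "K > 0" using len by (metis ennreal_neg not_less not_less_zero)
  obtain S D where S: "finite S" and cg: "continuous_on {0..1} g"
    and D: "\<And>t. t \<in> {0..1} - S \<Longrightarrow> (g has_vector_derivative D t) (at t)"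
    and cD: "continuous_on ({0..1} - S) D"
    using valid unfolding valid_path_def piecewise_C1_differentiable_on_def
      C1_differentiable_on_def by blast
  \<comment> \<open>The Riemannian speed, set to 0 at the breakpoints and outside the unit interval.
    This makes it Borel on the whole line and changes the integrand of \<open>lengthH\<close> only
    on a null set.\<close>
  define \<sigma> where "\<sigma> t = indicator ({0..1} - S) t *\<^sub>R (norm (D t) / sqrt (snd (g t)))" for t
  have cs0: "continuous_on ({0..1} - S) (\<lambda>t. norm (D t) / sqrt (snd (g t)))"
    using pos by (intro continuous_intros cD continuous_on_subset[OF cg]) (auto, force)
  have "{0..1} - S \<in> sets borel"
    using S by (intro sets.Diff) (auto intro: borel_closed finite_imp_closed)
  then have meas: "\<sigma> \<in> borel_measurable borel"
    unfolding \<sigma>_def using cs0 by (intro borel_measurable_continuous_on_indicator)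
  have \<sigma>0: "\<sigma> t \<ge> 0" for t
    using pos[of t] by (auto simp: \<sigma>_def indicator_def)
  have "lengthH g = (\<integral>\<^sup>+ t. ennreal (\<sigma> t) \<partial>lborel)"
    unfolding lengthH_def
  proof (rule nn_integral_cong_AE)
    have "AE t in lborel. t \<notin> S"
      using S by (intro AE_not_in) (auto intro: finite_imp_null_set_lborel)
    then show "AE t in lborel. speedH (g t) (vector_derivative g (at t)) * indicator {0..1} t = ennreal (\<sigma> t)"
    proof eventually_elim
      case (elim t)
      then show ?case
        using pos[of t] vector_derivative_at[OF D, of t]
        by (auto simp: \<sigma>_def speedH_def indicator_def)
    qed
  qed
  then have fin: "(\<integral>\<^sup>+ t. ennreal (\<sigma> t) \<partial>lborel) < ennreal K" using len by simp
  have int_L: "integrable lborel \<sigma>"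
    by (rule integrableI_nonneg) (use meas \<sigma>0 fin in \<open>auto intro: less_trans\<close>)
  have "\<sigma> integrable_on UNIV" and int_eq: "integral UNIV \<sigma> = integral\<^sup>L lborel \<sigma>"
    using has_integral_integral_lborel[OF int_L] by (auto simp: integrable_on_def integral_unique)
  have "ennreal (integral\<^sup>L lborel \<sigma>) < ennreal K"
    using fin nn_integral_eq_integral[OF int_L] \<sigma>0 by simp
  then have LK: "integral UNIV \<sigma> < K"
    using int_eq by (simp add: ennreal_less_iff \<sigma>0)
  have \<sigma>_int: "\<sigma> integrable_on {0..1}"
    using \<open>\<sigma> integrable_on UNIV\<close> by (rule integrable_on_subinterval) auto
  have L_eq: "integral {0..1} \<sigma> = integral UNIV \<sigma>"
    by (rule integral_spike_set) (auto simp: \<sigma>_def indicator_def intro!: negligible_subset[of "{}"])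
  define \<eta> where "\<eta> = K - integral {0..1} \<sigma>"
  have \<eta>: "\<eta> > 0" using LK L_eq by (simp add: \<eta>_def)
  \<comment> \<open>The slack \<open>\<eta>\<close> makes \<open>\<tau>\<close> run over all of \<open>[0,1]\<close> even if the path is constant.\<close>
  define \<tau> where "\<tau> t = (integral {0..t} \<sigma> + \<eta> * t) / K" for t
  have \<tau>01: "\<tau> 0 = 0" "\<tau> 1 = 1" using K by (auto simp: \<tau>_def \<eta>_def)
  have c\<tau>: "continuous_on {0..1} \<tau>"
    unfolding \<tau>_def using K by (intro continuous_intros indefinite_integral_continuous_1 \<sigma>_int) auto
  have \<tau>_in: "\<tau> t \<in> {0..1}" if "t \<in> {0..1}" for t
  proof -
    have i: "\<sigma> integrable_on {0..t}" using \<sigma>_int by (rule integrable_on_subinterval) (use that in auto)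
    have "0 \<le> integral {0..t} \<sigma>" using i \<sigma>0 by (intro integral_nonneg) auto
    moreover have "integral {0..t} \<sigma> \<le> integral {0..1} \<sigma>"
      using that i \<sigma>_int \<sigma>0 by (intro integral_subset_le) auto
    moreover have "\<eta> * t \<le> \<eta>" "0 \<le> \<eta> * t" using \<eta> that by (auto simp: mult_le_cancel_left1)
    ultimately show ?thesis using K \<eta>_def by (auto simp: \<tau>_def divide_simps)
  qed
  define h where "h t = K\<^sup>2 * \<tau> t - (4 * \<omega> * fst (g t) + 4 * (m (\<tau> t) * snd (g t)))" for t
  have "h 0 \<le> h 1"
  proof (rule nonneg_derivative_imp_le[where h = h, OF S])
    have "continuous_on {0..1} m"
      by (intro continuous_at_imp_continuous_on ballI DERIV_isCont[OF m])
    then have "continuous_on {0..1} (\<lambda>t. m (\<tau> t))"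
      using \<tau>_in by (intro continuous_on_compose2[OF _ c\<tau>]) auto
    then show "continuous_on {0..1} h"
      unfolding h_def by (intro continuous_intros c\<tau> cg)
    fix t assume t: "t \<in> {0<..<1::real} - S"
    have op: "open ({0<..<1} - S)" using S by (auto intro: open_Diff finite_imp_closed)
    have "continuous_on ({0<..<1} - S) (\<lambda>t. norm (D t) / sqrt (snd (g t)))"
      using cs0 by (rule continuous_on_subset) auto
    then have "continuous_on ({0<..<1} - S) \<sigma>"
      by (rule continuous_on_eq) (auto simp: \<sigma>_def)
    then have "isCont \<sigma> t" using op t by (simp add: continuous_on_eq_continuous_at)
    then have "((\<lambda>u. integral {0..u} \<sigma>) has_real_derivative \<sigma> t) (at t)"
      using t by (intro indefinite_integral_has_real_derivative_at[OF \<sigma>_int]) auto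
    then have d\<tau>: "(\<tau> has_real_derivative (\<sigma> t + \<eta>) / K) (at t)"
      unfolding \<tau>_def using K by (auto intro!: derivative_eq_intros)
    have dm: "((\<lambda>t. m (\<tau> t)) has_real_derivative - (\<omega>\<^sup>2 + (m (\<tau> t))\<^sup>2) * ((\<sigma> t + \<eta>) / K)) (at t)"
      using DERIV_chain2[OF m d\<tau>] \<tau>_in[of t] t by auto
    have gd: "(g has_derivative (\<lambda>y. y *\<^sub>R D t)) (at t)"
      using D[of t] t by (auto simp: has_vector_derivative_def)
    have d1: "((\<lambda>t. fst (g t)) has_real_derivative fst (D t)) (at t)"
      using has_derivative_fst[OF gd]
      by (simp add: has_real_derivative_iff_has_vector_derivative has_vector_derivative_def)
    have d2: "((\<lambda>t. snd (g t)) has_real_derivative snd (D t)) (at t)"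
      using has_derivative_snd[OF gd]
      by (simp add: has_real_derivative_iff_has_vector_derivative has_vector_derivative_def)
    define u where "u = (\<sigma> t + \<eta>) / K"
    note d\<tau> = d\<tau>[folded u_def] and dm = dm[folded u_def]
    let ?D = "K\<^sup>2 * u - (4 * \<omega> * fst (D t) + 4 * (- (\<omega>\<^sup>2 + (m (\<tau> t))\<^sup>2) * u * snd (g t) + snd (D t) * m (\<tau> t)))"
    have "(h has_real_derivative ?D) (at t)"
      unfolding h_def by (intro DERIV_diff DERIV_add DERIV_cmult d\<tau> d1 DERIV_mult dm d2)
    moreover have "4 * \<omega> * fst (D t) + 4 * m (\<tau> t) * snd (D t)
        - 4 * (\<omega>\<^sup>2 + (m (\<tau> t))\<^sup>2) * snd (g t) * u \<le> K\<^sup>2 * u"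
    proof (rule calibration_pointwise)
      show "0 < snd (g t)" using pos t by auto
      show "0 \<le> u" unfolding u_def using \<sigma>0 \<eta> K by (simp add: less_imp_le)
      have "norm (D t) = sqrt (snd (g t)) * \<sigma> t" using t pos[of t] by (auto simp: \<sigma>_def)
      also have "\<dots> \<le> sqrt (snd (g t)) * (\<sigma> t + \<eta>)"
        using t pos[of t] \<eta> by (intro mult_left_mono) auto
      finally show "norm (fst (D t), snd (D t)) \<le> sqrt (snd (g t)) * (K * u)"
        using K by (simp add: u_def)
    qed
    ultimately show "\<exists>D\<ge>0. (h has_real_derivative D) (at t)"
      by (intro exI[of _ ?D]) (auto simp: algebra_simps)
  qed auto
  then show ?thesis by (simp add: h_def \<tau>01 algebra_simps)
qed

section \<open>Bijectivity of the function \<open>\<delta> \<mapsto> f(v, \<delta>)\<close>\<close>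

text \<open>The difference vanishes at 0 and has derivative \<open>t * sin t\<close>. It is the
  numerator of \<open>phiB\<close> and, up to a factor 2, of the derivative of
  \<open>phiA\<close>.\<close>

lemma sin_gt_mult_cos:
  fixes w :: real
  assumes "0 < w" "w < pi"
  shows "w * cos w < sin w"
proof -
  have "sin 0 - 0 * cos 0 < sin w - w * cos w"
  proof (rule DERIV_pos_imp_increasing_open[OF \<open>0 < w\<close>])
    fix t assume "0 < t" "t < w"
    then have "0 < t * sin t" using assms by (intro mult_pos_pos sin_gt_zero) auto
    then show "\<exists>y. ((\<lambda>t. sin t - t * cos t) has_real_derivative y) (at t) \<and> y > 0"
      by (intro exI[of _ "t * sin t"]) (auto intro!: derivative_eq_intros)
  qed (auto intro!: continuous_intros)
  then show ?thesis by simp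
qed

lemma sin_mult_cos_less:
  fixes w :: real
  assumes "0 < w" "w < pi"
  shows "sin w * cos w < w"
proof -
  have "0 - sin 0 * cos 0 < w - sin w * cos w"
  proof (rule DERIV_pos_imp_increasing_open[OF \<open>0 < w\<close>])
    fix t assume "0 < t" "t < w"
    then have "0 < sin t" using assms by (intro sin_gt_zero) auto
    then have "0 < 2 * (sin t)\<^sup>2" by simp
    moreover have "((\<lambda>t. t - sin t * cos t) has_real_derivative 2 * (sin t)\<^sup>2) (at t)"
      using sin_cos_squared_add[of t] by (auto intro!: derivative_eq_intros simp: power2_eq_square)
    ultimately show "\<exists>y. ((\<lambda>t. t - sin t * cos t) has_real_derivative y) (at t) \<and> y > 0"
      by blast
  qed (auto intro!: continuous_intros)
  then show ?thesis by simp
qed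

text \<open>With \<open>w\<close> half of \<open>\<delta>\<close>, \<open>phiA\<close> and
  \<open>phiB\<close> are the coefficients of \<open>v + 1\<close> and \<open>2 * sqrt v\<close> in
  \<open>fH\<close>. Both are odd, and both are positive and increasing on (0, pi).\<close>

definition phiA :: "real \<Rightarrow> real" where
  "phiA w = (w - sin w * cos w) / (sin w)\<^sup>2"

definition phiB :: "real \<Rightarrow> real" where
  "phiB w = (sin w - w * cos w) / (sin w)\<^sup>2"

lemma phi_minus: "phiA (- w) = - phiA w" "phiB (- w) = - phiB w"
  by (auto simp: phiA_def phiB_def minus_divide_left)

lemma phiA_deriv:
  assumes "sin w \<noteq> 0"
  shows "(phiA has_real_derivative 2 * (sin w - w * cos w) / (sin w)^3) (at w)"
proof -
  have "((\<lambda>w. (w - sin w * cos w) / (sin w)\<^sup>2) has_real_derivative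
      ((1 - (cos w * cos w - sin w * sin w)) * (sin w)\<^sup>2 - (w - sin w * cos w) * (2 * sin w * cos w))
       / ((sin w)\<^sup>2 * (sin w)\<^sup>2)) (at w)"
    using assms by (auto intro!: derivative_eq_intros)
  also have "1 - (cos w * cos w - sin w * sin w) = 2 * (sin w)\<^sup>2"
    using sin_cos_squared_add[of w] by (simp add: power2_eq_square)
  also have "(2 * (sin w)\<^sup>2 * (sin w)\<^sup>2 - (w - sin w * cos w) * (2 * sin w * cos w))
      = 2 * sin w * (sin w - w * cos w)"
    using sin_cos_squared_add[of w] by algebra
  also have "\<dots> / ((sin w)\<^sup>2 * (sin w)\<^sup>2) = 2 * (sin w - w * cos w) / (sin w)^3"
    using assms by (simp add: field_simps power2_eq_square power3_eq_cube)
  finally show ?thesis by (simp add: phiA_def[abs_def])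
qed

lemma phiB_deriv:
  assumes "sin w \<noteq> 0"
  shows "(phiB has_real_derivative (w * (1 + (cos w)\<^sup>2) - 2 * sin w * cos w) / (sin w)^3) (at w)"
proof -
  have "((\<lambda>w. (sin w - w * cos w) / (sin w)\<^sup>2) has_real_derivative
      ((w * sin w) * (sin w)\<^sup>2 - (sin w - w * cos w) * (2 * sin w * cos w))
       / ((sin w)\<^sup>2 * (sin w)\<^sup>2)) (at w)"
    using assms by (auto intro!: derivative_eq_intros)
  also have "(w * sin w) * (sin w)\<^sup>2 - (sin w - w * cos w) * (2 * sin w * cos w)
      = sin w * (w * (1 + (cos w)\<^sup>2) - 2 * sin w * cos w)"
    using sin_cos_squared_add[of w] by algebra
  also have "\<dots> / ((sin w)\<^sup>2 * (sin w)\<^sup>2) = (w * (1 + (cos w)\<^sup>2) - 2 * sin w * cos w) / (sin w)^3"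
    using assms by (simp add: field_simps power2_eq_square power3_eq_cube)
  finally show ?thesis by (simp add: phiB_def[abs_def])
qed

text \<open>The expression vanishes at 0, and its derivative factors as
  \<open>sin t * (3 * sin t - 2 * (t * cos t))\<close>, which is positive by
  \<open>sin_gt_mult_cos\<close>.\<close>

lemma phiB_deriv_numerator_pos:
  fixes w :: real
  assumes "0 < w" "w < pi"
  shows "0 < w * (1 + (cos w)\<^sup>2) - 2 * sin w * cos w"
proof -
  let ?h = "\<lambda>t::real. t * (1 + (cos t)\<^sup>2) - 2 * sin t * cos t"
  have "?h 0 < ?h w"
  proof (rule DERIV_pos_imp_increasing_open[OF \<open>0 < w\<close>])
    fix t assume t: "0 < t" "t < w"
    then have s: "0 < sin t" using assms by (intro sin_gt_zero) auto
    have "0 < sin t * (3 * sin t - 2 * (t * cos t))"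
      using s sin_gt_mult_cos[of t] t assms by (intro mult_pos_pos) auto
    moreover have "(?h has_real_derivative
        1 + (cos t)\<^sup>2 + t * (2 * cos t * (- sin t)) - (2 * cos t * cos t + 2 * sin t * (- sin t))) (at t)"
      by (auto intro!: derivative_eq_intros)
    moreover have "1 + (cos t)\<^sup>2 + t * (2 * cos t * (- sin t)) - (2 * cos t * cos t + 2 * sin t * (- sin t))
        = sin t * (3 * sin t - 2 * (t * cos t))"
      using sin_cos_squared_add[of t] by (simp add: power2_eq_square algebra_simps)
    ultimately show "\<exists>y. (?h has_real_derivative y) (at t) \<and> y > 0" by metis
  qed (auto intro!: continuous_intros)
  then show ?thesis by simp
qed

lemma phi_strict_mono:
  assumes "0 < w1" "w1 < w2" "w2 < pi"
  shows "phiA w1 < phiA w2" "phiB w1 < phiB w2"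
proof -
  have s: "0 < sin t" if "w1 \<le> t" "t \<le> w2" for t using that assms by (intro sin_gt_zero) auto
  have "0 < 2 * (sin t - t * cos t) / (sin t)^3" if "w1 \<le> t" "t \<le> w2" for t
    using s[OF that] sin_gt_mult_cos[of t] that assms by simp
  then show "phiA w1 < phiA w2"
    using s by (intro DERIV_pos_imp_increasing[OF \<open>w1 < w2\<close>]) (metis phiA_deriv less_irrefl)
  have "0 < (t * (1 + (cos t)\<^sup>2) - 2 * sin t * cos t) / (sin t)^3" if "w1 \<le> t" "t \<le> w2" for t
    using s[OF that] phiB_deriv_numerator_pos[of t] that assms by simp
  then show "phiB w1 < phiB w2"
    using s by (intro DERIV_pos_imp_increasing[OF \<open>w1 < w2\<close>]) (metis phiB_deriv less_irrefl)
qed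

lemma phi_pos:
  assumes "0 < w" "w < pi"
  shows "0 < phiA w" "0 < phiB w"
  using assms sin_gt_zero[of w] sin_mult_cos_less[of w] sin_gt_mult_cos[of w]
  by (auto simp: phiA_def phiB_def)

text \<open>Also true at \<open>\<delta> = 0\<close>, where both quotients on the right are \<open>0/0 = 0\<close>.\<close>

lemma fH_eq_phi: "fH v \<delta> = (v + 1) * phiA (\<delta>/2) + 2 * sqrt v * phiB (\<delta>/2)"
proof -
  have "sin \<delta> = 2 * sin (\<delta>/2) * cos (\<delta>/2)" using sin_double[of "\<delta>/2"] by simp
  then show ?thesis
    by (cases "sin (\<delta>/2) = 0") (auto simp: fH_def phiA_def phiB_def field_simps)
qed

text \<open>Strictness comes from \<open>phiA\<close>, whose weight \<open>v + 1\<close> is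
  positive; the weight of \<open>phiB\<close> vanishes on the boundary \<open>v = 0\<close>.\<close>

lemma fH_strict_mono:
  assumes "0 \<le> v" "0 < a" "a < b" "b < 2 * pi"
  shows "fH v a < fH v b"
  unfolding fH_eq_phi using assms phi_strict_mono[of "a/2" "b/2"]
  by (intro add_less_le_mono mult_strict_left_mono mult_left_mono) auto

lemma fH_pos:
  assumes "0 \<le> v" "0 < \<delta>" "\<delta> < 2 * pi"
  shows "0 < fH v \<delta>"
  unfolding fH_eq_phi using assms phi_pos[of "\<delta>/2"]
  by (auto intro!: add_pos_nonneg)

lemma fH_minus: "fH v (- \<delta>) = - fH v \<delta>"
  using phi_minus[of "\<delta>/2"] by (simp add: fH_eq_phi)

lemma fH_inj:
  assumes v: "0 \<le> v" and ab: "\<bar>a\<bar> < 2 * pi" "\<bar>b\<bar> < 2 * pi" and eq: "fH v a = fH v b"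
  shows "a = b"
proof -
  have pos: "\<delta> > 0 \<Longrightarrow> fH v \<delta> > 0" and neg: "\<delta> < 0 \<Longrightarrow> fH v \<delta> < 0" if "\<bar>\<delta>\<bar> < 2 * pi" for \<delta>
    using fH_pos[of v \<delta>] fH_pos[of v "-\<delta>"] fH_minus[of v \<delta>] v that by auto
  have zero: "fH v 0 = 0" by (simp add: fH_def)
  have mono: "a = b" if "0 < a" "0 < b" "\<bar>a\<bar> < 2 * pi" "\<bar>b\<bar> < 2 * pi" "fH v a = fH v b" for a b
    using fH_strict_mono[OF v, of a b] fH_strict_mono[OF v, of b a] that
    by (cases a b rule: linorder_cases) auto
  consider "0 < a" "0 < b" | "a < 0" "b < 0" | "a = 0" "b = 0"
    using pos[OF ab(1)] neg[OF ab(1)] pos[OF ab(2)] neg[OF ab(2)] eq zero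
    by (cases a "0::real" rule: linorder_cases; cases b "0::real" rule: linorder_cases) auto
  then show ?thesis
    using mono[of a b] mono[of "-a" "-b"] ab eq fH_minus[of v a] fH_minus[of v b] by cases auto
qed

text \<open>Intermediate value theorem in the half angle: the function tends to 0 at 0 and is
  unbounded near pi.\<close>

lemma fH_surj_pos:
  assumes v: "0 \<le> v" and x: "0 < x"
  shows "\<exists>\<delta>. 0 < \<delta> \<and> \<delta> < 2 * pi \<and> fH v \<delta> = x"
proof -
  let ?F = "\<lambda>w. (v + 1) * phiA w + 2 * sqrt v * phiB w"
  have A0: "(phiA \<longlongrightarrow> 0) (at_right 0)" unfolding phiA_def by real_asymp
  have B0: "(phiB \<longlongrightarrow> 0) (at_right 0)" unfolding phiB_def by real_asymp
  have Api: "filterlim phiA at_top (at_left pi)" unfolding phiA_def by real_asymp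
  have "(?F \<longlongrightarrow> (v + 1) * 0 + 2 * sqrt v * 0) (at_right 0)"
    by (intro tendsto_intros A0 B0)
  then have "\<forall>\<^sub>F w in at_right 0. ?F w < x" using x by (auto dest: order_tendstoD)
  moreover have "\<forall>\<^sub>F w in at_right 0. w \<in> {0<..<pi}" by (rule eventually_at_right_real) simp
  ultimately have "\<forall>\<^sub>F w in at_right 0. ?F w < x \<and> w \<in> {0<..<pi}" by eventually_elim auto
  then obtain w1 where w1: "?F w1 < x" "0 < w1" "w1 < pi"
    using eventually_happens trivial_limit_at_right_real by fastforce
  have "\<forall>\<^sub>F w in at_left pi. x \<le> phiA w" using Api by (auto simp: filterlim_at_top)
  moreover have "\<forall>\<^sub>F w in at_left pi. w \<in> {w1<..<pi}" using w1 by (intro eventually_at_left_real)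
  ultimately have "\<forall>\<^sub>F w in at_left pi. x \<le> phiA w \<and> w \<in> {w1<..<pi}" by eventually_elim auto
  then obtain w2 where w2: "x \<le> phiA w2" "w1 < w2" "w2 < pi"
    using eventually_happens trivial_limit_at_left_real by fastforce
  have p: "0 < phiA w2" "0 < phiB w2" using phi_pos[of w2] w1 w2 by auto
  \<comment> \<open>The blow-up of \<open>phiA\<close> alone suffices, because \<open>v + 1\<close>
    is at least 1 and the \<open>phiB\<close> term is nonnegative.\<close>
  have "1 * phiA w2 + 0 \<le> ?F w2"
    using p v by (intro add_mono mult_right_mono mult_nonneg_nonneg) auto
  then have "x \<le> ?F w2" using w2 by simp
  moreover have "continuous_on {w1..w2} ?F"
  proof -
    have "sin t \<noteq> 0" if "t \<in> {w1..w2}" for t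
      using that w1 w2 sin_gt_zero[of t] by auto
    then show ?thesis unfolding phiA_def phiB_def by (intro continuous_intros) auto
  qed
  ultimately obtain w where "w1 \<le> w" "w \<le> w2" "?F w = x"
    using IVT'[of ?F w1 x w2] w1 w2 by auto
  then show ?thesis using w1 w2 by (intro exI[of _ "2 * w"]) (auto simp: fH_eq_phi)
qed

text \<open>Existence and uniqueness give the definite description in \<open>deltaH\<close> its
  meaning. Oddness reduces existence to positive \<open>x\<close>.\<close>

lemma deltaH_spec:
  assumes v: "0 \<le> v"
  shows "\<bar>deltaH x v\<bar> < 2 * pi" "fH v (deltaH x v) = x"
proof -
  have "\<exists>\<delta>. \<bar>\<delta>\<bar> < 2 * pi \<and> fH v \<delta> = x"
  proof (cases x "0::real" rule: linorder_cases)
    case less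
    then obtain \<delta> where "0 < \<delta>" "\<delta> < 2 * pi" "fH v \<delta> = - x"
      using fH_surj_pos[OF v, of "- x"] by auto
    then show ?thesis by (intro exI[of _ "- \<delta>"]) (auto simp: fH_minus)
  next
    case equal
    then show ?thesis by (intro exI[of _ 0]) (auto simp: fH_def)
  next
    case greater
    then show ?thesis using fH_surj_pos[OF v, of x] by force
  qed
  then have "\<exists>!\<delta>. \<bar>\<delta>\<bar> < 2 * pi \<and> fH v \<delta> = x"
    using fH_inj[OF v] by metis
  then have "\<exists>!\<delta>. - 2 * pi < \<delta> \<and> \<delta> < 2 * pi \<and> fH v \<delta> = x"
    by (simp add: abs_less_iff minus_less_iff[of "2 * pi"] conj_commute conj_left_commute)
  then have "- 2 * pi < deltaH x v \<and> deltaH x v < 2 * pi \<and> fH v (deltaH x v) = x"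
    unfolding deltaH_def by (rule theI')
  then show "\<bar>deltaH x v\<bar> < 2 * pi" "fH v (deltaH x v) = x" by auto
qed

section \<open>Harmonic oscillator with prescribed end values\<close>

text \<open>The solution of \<open>y'' = -\<omega>\<^sup>2 y\<close> with \<open>y(0) = 0\<close> and \<open>y(1) = 1\<close>, and its derivative.\<close>

definition sin_ratio :: "real \<Rightarrow> real \<Rightarrow> real" where
  "sin_ratio \<omega> t = (if \<omega> = 0 then t else sin (\<omega> * t) / sin \<omega>)"

definition sin_ratio' :: "real \<Rightarrow> real \<Rightarrow> real" where
  "sin_ratio' \<omega> t = (if \<omega> = 0 then 1 else \<omega> * cos (\<omega> * t) / sin \<omega>)"

definition osc :: "real \<Rightarrow> real \<Rightarrow> real \<Rightarrow> real \<Rightarrow> real" where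
  "osc \<omega> a b t = a * sin_ratio \<omega> (1 - t) + b * sin_ratio \<omega> t"

definition osc' :: "real \<Rightarrow> real \<Rightarrow> real \<Rightarrow> real \<Rightarrow> real" where
  "osc' \<omega> a b t = b * sin_ratio' \<omega> t - a * sin_ratio' \<omega> (1 - t)"

lemma sin_neq_zero:
  fixes \<omega> :: real
  assumes "\<omega> \<noteq> 0" "\<bar>\<omega>\<bar> < pi"
  shows "sin \<omega> \<noteq> 0"
  using assms sin_gt_zero[of \<omega>] sin_gt_zero[of "-\<omega>"] by (cases "\<omega> > 0") auto

text \<open>No restriction on \<open>\<omega>\<close> is made: if \<open>sin \<omega> = 0\<close>
  with nonzero \<open>\<omega>\<close>, division by zero turns both functions into the constant
  0.\<close>

lemma sin_ratio_deriv:
  "(sin_ratio \<omega> has_real_derivative sin_ratio' \<omega> t) (at t)"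
  "(sin_ratio' \<omega> has_real_derivative - \<omega>\<^sup>2 * sin_ratio \<omega> t) (at t)"
  unfolding sin_ratio_def[abs_def] sin_ratio'_def[abs_def]
  by (cases "\<omega> = 0"; cases "sin \<omega> = 0";
      auto intro!: derivative_eq_intros simp: power2_eq_square)+

lemma osc_deriv:
  "(osc \<omega> a b has_real_derivative osc' \<omega> a b t) (at t)"
  "(osc' \<omega> a b has_real_derivative - \<omega>\<^sup>2 * osc \<omega> a b t) (at t)"
proof -
  have inner: "((\<lambda>t. 1 - t) has_real_derivative - 1) (at t)"
    by (auto intro!: derivative_eq_intros)
  note c = DERIV_chain2[OF sin_ratio_deriv(1) inner] DERIV_chain2[OF sin_ratio_deriv(2) inner]
  show "(osc \<omega> a b has_real_derivative osc' \<omega> a b t) (at t)"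
    unfolding osc_def[abs_def] osc'_def
    by (auto intro!: derivative_eq_intros c sin_ratio_deriv)
  show "(osc' \<omega> a b has_real_derivative - \<omega>\<^sup>2 * osc \<omega> a b t) (at t)"
    unfolding osc_def osc'_def[abs_def]
    by (auto intro!: derivative_eq_intros c sin_ratio_deriv simp: algebra_simps)
qed

lemma osc_ends:
  assumes "\<bar>\<omega>\<bar> < pi"
  shows "osc \<omega> a b 0 = a" "osc \<omega> a b 1 = b"
  using sin_neq_zero[of \<omega>] assms by (auto simp: osc_def sin_ratio_def)

text \<open>This is the absence of conjugate points: for \<open>\<omega>\<close> in (0, pi) both
  sines are positive, and the ratio is even in \<open>\<omega>\<close>.\<close>

lemma sin_ratio_pos:
  assumes "\<bar>\<omega>\<bar> < pi" "0 < t" "t \<le> 1"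
  shows "0 < sin_ratio \<omega> t"
proof -
  have *: "0 < sin_ratio \<omega> t" if "0 < \<omega>" "\<omega> < pi" for \<omega>
  proof -
    have "\<omega> * t < pi" using that assms by (smt (verit) mult_left_le)
    then have "0 < sin (\<omega> * t)" "0 < sin \<omega>" using that assms by (auto intro!: sin_gt_zero)
    then show ?thesis using that by (simp add: sin_ratio_def)
  qed
  have "sin_ratio (- \<omega>) t = sin_ratio \<omega> t" by (simp add: sin_ratio_def)
  then show ?thesis
    using *[of \<omega>] *[of "- \<omega>"] assms
    by (cases \<omega> "0::real" rule: linorder_cases) (auto simp: sin_ratio_def)
qed

text \<open>Excluding \<open>t = 1\<close> admits \<open>b = 0\<close>, that is, a curve that
  reaches the boundary only at its end.\<close>

lemma osc_pos:
  assumes \<omega>: "\<bar>\<omega>\<bar> < pi" and "0 < a" "0 \<le> b" "0 \<le> t" "t < 1"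
  shows "0 < osc \<omega> a b t"
proof -
  have "0 < sin_ratio \<omega> (1 - t)" using assms by (intro sin_ratio_pos) auto
  moreover have "0 \<le> sin_ratio \<omega> t"
    using sin_ratio_pos[OF \<omega>, of t] assms by (cases "t = 0") (auto simp: sin_ratio_def)
  ultimately show ?thesis unfolding osc_def using assms
    by (intro add_pos_nonneg mult_pos_pos mult_nonneg_nonneg)
qed

text \<open>Conservation of the oscillator energy; it is the reason why the minimising curve has
  constant speed.\<close>

lemma osc_energy:
  "\<omega>\<^sup>2 * (osc \<omega> a b t)\<^sup>2 + (osc' \<omega> a b t)\<^sup>2 = \<omega>\<^sup>2 * (osc \<omega> a b 0)\<^sup>2 + (osc' \<omega> a b 0)\<^sup>2"
proof -
  have "((\<lambda>t. \<omega>\<^sup>2 * (osc \<omega> a b t)\<^sup>2 + (osc' \<omega> a b t)\<^sup>2) has_real_derivative 0) (at t)" for t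
    by (auto intro!: derivative_eq_intros osc_deriv)
  then show ?thesis by (intro DERIV_isconst_all) auto
qed

section \<open>The distance\<close>

text \<open>Raising a path by \<open>\<epsilon>\<close> does not increase its length and moves it off the boundary, where
  the metric is singular.\<close>

lemma lengthH_raise:
  assumes "path_image g \<subseteq> Hplane" "0 < \<epsilon>"
  shows "lengthH (\<lambda>t. g t + (0, \<epsilon>)) \<le> lengthH g"
  unfolding lengthH_def
proof (rule nn_integral_mono)
  fix t :: real
  \<comment> \<open>The constant cancels in the difference quotient, so this holds even where
    \<open>g\<close> is not differentiable.\<close>
  have vd: "vector_derivative (\<lambda>t. g t + (0, \<epsilon>)) (at t) = vector_derivative g (at t)"
    by (simp add: vector_derivative_def has_vector_derivative_def has_derivative_def)
  show "speedH (g t + (0, \<epsilon>)) (vector_derivative (\<lambda>t. g t + (0, \<epsilon>)) (at t)) * indicator {0..1} t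
      \<le> speedH (g t) (vector_derivative g (at t)) * indicator {0..1} t"
  proof (cases "t \<in> {0..1}")
    case True
    then have "0 \<le> snd (g t)" using assms by (force simp: path_image_def Hplane_def)
    then have "speedH (g t + (0, \<epsilon>)) w \<le> speedH (g t) w" for w
      using \<open>0 < \<epsilon>\<close> by (auto simp: speedH_def intro!: ennreal_leI divide_left_mono)
    then show ?thesis by (simp add: vd mult_right_mono)
  qed simp
qed

text \<open>The path is raised by \<open>\<epsilon>\<close>, the calibration with
  \<open>m = osc' / osc\<close> is applied to it, and \<open>\<epsilon>\<close> tends to 0. Paths
  touching the boundary are thus covered.\<close>

lemma length_lower_bound:
  assumes \<omega>: "\<bar>\<omega>\<bar> < pi" and g: "valid_path g" "path_image g \<subseteq> Hplane"
    and ends: "pathstart g = (0, 1)" "pathfinish g = (x, v)" and len: "lengthH g < ennreal K"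
  shows "4 * \<omega> * x + 4 * ((v + 1) * sin_ratio' \<omega> 1 - 2 * sqrt v * sin_ratio' \<omega> 0) \<le> K\<^sup>2"
proof -
  have v: "0 \<le> v"
    using ends(2) g(2) pathfinish_in_path_image[of g] by (auto simp: Hplane_def)
  have "4 * \<omega> * x + 4 * ((v + 1 + 2 * \<epsilon>) * sin_ratio' \<omega> 1
      - 2 * sqrt (1 + \<epsilon>) * sqrt (v + \<epsilon>) * sin_ratio' \<omega> 0) \<le> K\<^sup>2" if \<epsilon>: "0 < \<epsilon>" for \<epsilon>
  proof -
    \<comment> \<open>Square roots of the heights of the raised end points. Both are positive, so
      \<open>osc\<close> has no zero on the closed interval and \<open>?m\<close> is defined
      there.\<close>
    define a b where "a = sqrt (1 + \<epsilon>)" and "b = sqrt (v + \<epsilon>)"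
    have ab: "0 < a" "0 < b" "a\<^sup>2 = 1 + \<epsilon>" "b\<^sup>2 = v + \<epsilon>" using \<epsilon> v by (auto simp: a_def b_def)
    let ?m = "\<lambda>t. osc' \<omega> a b t / osc \<omega> a b t"
    have pos: "0 < osc \<omega> a b t" if "t \<in> {0..1}" for t
      using osc_pos[OF \<omega>, of a b t] osc_ends(2)[OF \<omega>, of a b] ab that by (cases "t = 1") auto
    have "4 * \<omega> * (fst (g 1 + (0, \<epsilon>)) - fst (g 0 + (0, \<epsilon>)))
        + 4 * (?m 1 * snd (g 1 + (0, \<epsilon>)) - ?m 0 * snd (g 0 + (0, \<epsilon>))) \<le> K\<^sup>2"
    proof (rule length_calibration)
      show "valid_path (\<lambda>t. g t + (0, \<epsilon>))"
        using g(1) unfolding valid_path_def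
        by (rule piecewise_C1_differentiable_add) (auto intro: C1_differentiable_imp_piecewise)
      show "0 < snd (g t + (0, \<epsilon>))" if "t \<in> {0..1}" for t
        using g(2) that \<epsilon> by (force simp: path_image_def Hplane_def intro: add_nonneg_pos)
      show "lengthH (\<lambda>t. g t + (0, \<epsilon>)) < ennreal K"
        using lengthH_raise[OF g(2) \<epsilon>] len by (rule le_less_trans)
      show "(?m has_real_derivative - (\<omega>\<^sup>2 + (?m t)\<^sup>2)) (at t)" if "t \<in> {0..1}" for t
        using pos[OF that]
        by (auto intro!: derivative_eq_intros osc_deriv simp: field_simps power2_eq_square)
    qed
    moreover have "fst (g 0) = 0" "snd (g 0) = 1" "fst (g 1) = x" "snd (g 1) = v"
      using ends by (auto simp: pathstart_def pathfinish_def)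
    ultimately have "4 * \<omega> * x + 4 * (?m 1 * b\<^sup>2 - ?m 0 * a\<^sup>2) \<le> K\<^sup>2"
      using ab by simp
    moreover have "?m 1 * b\<^sup>2 - ?m 0 * a\<^sup>2 = (a\<^sup>2 + b\<^sup>2) * sin_ratio' \<omega> 1 - 2 * a * b * sin_ratio' \<omega> 0"
      using ab(1,2) by (simp add: osc_ends[OF \<omega>] osc'_def power2_eq_square field_simps)
    moreover have "a\<^sup>2 + b\<^sup>2 = v + 1 + 2 * \<epsilon>" using ab by simp
    ultimately show ?thesis by (simp flip: a_def b_def)
  qed
  then have "\<forall>\<^sub>F \<epsilon> in at_right 0. 4 * \<omega> * x + 4 * ((v + 1 + 2 * \<epsilon>) * sin_ratio' \<omega> 1
      - 2 * sqrt (1 + \<epsilon>) * sqrt (v + \<epsilon>) * sin_ratio' \<omega> 0) \<le> K\<^sup>2"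
    by (auto simp: eventually_at_filter)
  moreover have "((\<lambda>\<epsilon>. 4 * \<omega> * x + 4 * ((v + 1 + 2 * \<epsilon>) * sin_ratio' \<omega> 1
      - 2 * sqrt (1 + \<epsilon>) * sqrt (v + \<epsilon>) * sin_ratio' \<omega> 0)) \<longlongrightarrow>
     4 * \<omega> * x + 4 * ((v + 1) * sin_ratio' \<omega> 1 - 2 * sqrt v * sin_ratio' \<omega> 0)) (at_right 0)"
    by (auto intro!: tendsto_eq_intros)
  ultimately show ?thesis by (intro tendsto_upperbound) auto
qed

section \<open>The minimising curve and the value of the distance\<close>

text \<open>Here \<open>s\<close> is the square root of the end height and \<open>E\<close> the
  squared speed, read off at time 0. The hypothesis on \<open>x\<close> says that the lower bound
  for this \<open>\<omega>\<close> equals \<open>E\<close>.\<close>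

lemma geodesic_exists:
  assumes \<omega>: "\<bar>\<omega>\<bar> < pi" and s: "0 \<le> s"
    and E: "E = 4 * (\<omega>\<^sup>2 + (s * sin_ratio' \<omega> 0 - sin_ratio' \<omega> 1)\<^sup>2)"
    and x: "4 * \<omega> * x + 4 * ((s\<^sup>2 + 1) * sin_ratio' \<omega> 1 - 2 * s * sin_ratio' \<omega> 0) = E"
    and x0: "\<omega> = 0 \<Longrightarrow> x = 0"
  shows "\<exists>g. valid_path g \<and> path_image g \<subseteq> Hplane \<and> pathstart g = (0, 1)
    \<and> pathfinish g = (x, s\<^sup>2) \<and> lengthH g = ennreal (sqrt E)"
proof -
  define r r' where "r = osc \<omega> 1 s" and "r' = osc' \<omega> 1 s"
  have r01: "r 0 = 1" "r 1 = s" using osc_ends[OF \<omega>] by (auto simp: r_def)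
  have r'01: "r' 0 = s * sin_ratio' \<omega> 0 - sin_ratio' \<omega> 1"
      "r' 1 = s * sin_ratio' \<omega> 1 - sin_ratio' \<omega> 0"
    by (auto simp: r'_def osc'_def)
  have dr: "(r has_real_derivative r' t) (at t)" "(r' has_real_derivative - \<omega>\<^sup>2 * r t) (at t)" for t
    unfolding r_def r'_def by (rule osc_deriv)+
  have energy: "4 * (\<omega>\<^sup>2 * (r t)\<^sup>2 + (r' t)\<^sup>2) = E" for t
    using osc_energy[of \<omega> 1 s t] r01 r'01 E by (simp add: r_def r'_def)
  \<comment> \<open>The primitive of \<open>2 * \<omega> * (r t)\<^sup>2\<close> vanishing at 0.
    Energy conservation gives \<open>8 * \<omega>\<^sup>2 * (r t)\<^sup>2\<close> as
    \<open>E\<close> minus four times the derivative of \<open>r t * r' t\<close>. For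
    \<open>\<omega> = 0\<close> the curve is vertical.\<close>
  define X where "X t = (if \<omega> = 0 then 0 else (E * t - 4 * (r t * r' t - r' 0)) / (4 * \<omega>))" for t
  define g where "g t = (X t, (r t)\<^sup>2)" for t
  define D where "D t = (2 * \<omega> * (r t)\<^sup>2, 2 * r t * r' t)" for t
  have dX: "(X has_real_derivative 2 * \<omega> * (r t)\<^sup>2) (at t)" for t
  proof (cases "\<omega> = 0")
    case True
    then show ?thesis by (simp add: X_def[abs_def])
  next
    case False
    have "((\<lambda>t. (E * t - 4 * (r t * r' t - r' 0)) / (4 * \<omega>)) has_real_derivative
        (E - 4 * (r' t * r' t - \<omega>\<^sup>2 * r t * r t)) / (4 * \<omega>)) (at t)"
      using False by (auto intro!: derivative_eq_intros dr simp: field_simps)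
    also have "(E - 4 * (r' t * r' t - \<omega>\<^sup>2 * r t * r t)) / (4 * \<omega>) = 2 * \<omega> * (r t)\<^sup>2"
      using False by (simp flip: energy[of t] add: field_simps power2_eq_square)
    finally show ?thesis using False by (simp add: X_def[abs_def])
  qed
  have dg: "(g has_vector_derivative D t) (at t)" for t
  proof -
    have "((\<lambda>t. (r t)\<^sup>2) has_real_derivative 2 * r t * r' t) (at t)"
      by (auto intro!: derivative_eq_intros dr)
    then show ?thesis unfolding g_def[abs_def] D_def
      by (intro has_vector_derivative_Pair dX[unfolded has_real_derivative_iff_has_vector_derivative])
         (simp add: has_real_derivative_iff_has_vector_derivative)
  qed
  have "continuous_on UNIV r" "continuous_on UNIV r'"
    using dr by (auto intro!: continuous_at_imp_continuous_on DERIV_isCont)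
  then have "continuous_on {0..1} D"
    unfolding D_def[abs_def] by (auto intro!: continuous_intros intro: continuous_on_subset)
  then have "g C1_differentiable_on {0..1}"
    using dg by (auto simp: C1_differentiable_on_def)
  then have 1: "valid_path g"
    unfolding valid_path_def by (rule C1_differentiable_imp_piecewise)
  have 2: "path_image g \<subseteq> Hplane" by (auto simp: path_image_def Hplane_def g_def)
  have 3: "pathstart g = (0, 1)" by (simp add: pathstart_def g_def X_def r01)
  \<comment> \<open>The matching hypothesis is exactly the end condition on \<open>X\<close>. For
    \<open>\<omega> = 0\<close> it does not determine \<open>x\<close>, and \<open>x0\<close> takes
    over.\<close>
  have "4 * \<omega> * x = E - 4 * (r 1 * r' 1 - r' 0)"
    using x by (simp add: r01 r'01 algebra_simps power2_eq_square)
  then have "X 1 = x" using x0 by (auto simp: X_def field_simps)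
  then have 4: "pathfinish g = (x, s\<^sup>2)" by (simp add: pathfinish_def g_def r01)
  have "lengthH g = (\<integral>\<^sup>+ t. ennreal (sqrt E) * indicator {0..1::real} t \<partial>lborel)"
    unfolding lengthH_def
  proof (rule nn_integral_cong_AE)
    \<comment> \<open>If \<open>s = 0\<close>, the curve arrives on the boundary with coordinate
      velocity 0, where \<open>speedH\<close> is 0 instead of \<open>sqrt E\<close>.\<close>
    have "AE t in lborel. t \<noteq> (1::real)" by (rule AE_lborel_singleton)
    then show "AE t in lborel. speedH (g t) (vector_derivative g (at t)) * indicator {0..1} t
        = ennreal (sqrt E) * indicator {0..1} t"
    proof eventually_elim
      case (elim t)
      show ?case
      proof (cases "t \<in> {0..1}")
        case True
        then have rt: "0 < r t" unfolding r_def using osc_pos[OF \<omega>, of 1 s t] s elim by auto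
        have "norm (D t) = sqrt (4 * (\<omega>\<^sup>2 * (r t)\<^sup>2 + (r' t)\<^sup>2) * (r t)\<^sup>2)"
          by (simp add: D_def norm_Pair power_mult_distrib algebra_simps flip: power_mult)
        also have "\<dots> = sqrt E * r t" using rt by (simp only: energy real_sqrt_mult) simp
        finally show ?thesis using rt vector_derivative_at[OF dg, of t] by (simp add: speedH_def g_def)
      qed simp
    qed
  qed
  also have "\<dots> = ennreal (sqrt E)" by (simp add: nn_integral_cmult_indicator)
  finally show ?thesis using 1 2 3 4 by blast
qed

lemma dH_eq:
  assumes \<omega>: "\<bar>\<omega>\<bar> < pi" and v: "0 \<le> v"
    and E: "E = 4 * (\<omega>\<^sup>2 + (sqrt v * sin_ratio' \<omega> 0 - sin_ratio' \<omega> 1)\<^sup>2)"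
    and x: "4 * \<omega> * x + 4 * ((v + 1) * sin_ratio' \<omega> 1 - 2 * sqrt v * sin_ratio' \<omega> 0) = E"
    and x0: "\<omega> = 0 \<Longrightarrow> x = 0"
  shows "dH (0, 1) (x, v) = sqrt E"
proof -
  let ?P = "{g. valid_path g \<and> path_image g \<subseteq> Hplane \<and> pathstart g = (0, 1) \<and> pathfinish g = (x, v)}"
  have E0: "0 \<le> E" unfolding E by simp
  have "\<exists>g. valid_path g \<and> path_image g \<subseteq> Hplane \<and> pathstart g = (0, 1)
      \<and> pathfinish g = (x, (sqrt v)\<^sup>2) \<and> lengthH g = ennreal (sqrt E)"
    by (rule geodesic_exists[OF \<omega> _ E _ x0]) (use v x in simp_all)
  then obtain g where g: "g \<in> ?P" "lengthH g = ennreal (sqrt E)"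
    using v by auto
  have "(INF g\<in>?P. lengthH g) = ennreal (sqrt E)"
  proof (rule antisym)
    show "(INF g\<in>?P. lengthH g) \<le> ennreal (sqrt E)" 
      using INF_lower[OF g(1), of lengthH] g(2) by simp
    show "ennreal (sqrt E) \<le> (INF g\<in>?P. lengthH g)"
    proof (rule INF_greatest, rule ccontr)
      fix g assume g: "g \<in> ?P" and "\<not> ennreal (sqrt E) \<le> lengthH g"
      \<comment> \<open>\<open>length_lower_bound\<close> needs a strict upper bound on the length;
        one chosen below \<open>sqrt E\<close> contradicts its conclusion.\<close>
      then obtain k where k: "lengthH g < k" "k < ennreal (sqrt E)"
        using dense[of "lengthH g" "ennreal (sqrt E)"] unfolding not_le by blast
      then obtain K where K: "k = ennreal K" "0 \<le> K" by (cases k) auto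
      have "E \<le> K\<^sup>2" using length_lower_bound[OF \<omega>, of g x v K] g k K x by auto
      moreover have "K < sqrt E" using k K by (simp add: ennreal_less_iff)
      ultimately show False using K E0 by (smt (verit) real_sqrt_le_iff real_sqrt_unique)
    qed
  qed
  then show ?thesis unfolding dH_def using E0 by simp
qed

section \<open>The closed form of the squared distance\<close>

text \<open>For \<open>x\<close> given by \<open>fH\<close>, the radicand in \<open>LambdaH\<close>
  is a perfect square. The right side is half the squared speed of the minimising curve.\<close>

lemma LambdaH_eq:
  assumes \<omega>: "\<omega> \<noteq> 0" "\<bar>\<omega>\<bar> < pi" and s: "0 \<le> s"
    and x: "x = (s\<^sup>2 + 1) * phiA \<omega> + 2 * s * phiB \<omega>"
  shows "LambdaH x (2 * \<omega>) = 2 * \<omega>\<^sup>2 * (1 + ((s - cos \<omega>) / sin \<omega>)\<^sup>2)"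
proof -
  define S C where "S = sin \<omega>" and "C = cos \<omega>"
  define a b where "a = \<omega> - S * C" and "b = S - \<omega> * C"
  have SC: "S\<^sup>2 + C\<^sup>2 = 1" by (simp add: S_def C_def)
  have S: "S \<noteq> 0" using sin_neq_zero \<omega> by (simp add: S_def)
  have pos: "0 < a / S" "0 < b / S"
  proof -
    have "0 < a / S \<and> 0 < b / S"
    proof (cases "0 < \<omega>")
      case True
      then have "0 < S" "0 < a" "0 < b"
        using sin_gt_zero[of \<omega>] sin_mult_cos_less[of \<omega>] sin_gt_mult_cos[of \<omega>] \<omega>
        by (auto simp: a_def b_def S_def C_def)
      then show ?thesis by simp
    next
      case False
      then have "S < 0" "a < 0" "b < 0"
        using sin_gt_zero[of "- \<omega>"] sin_mult_cos_less[of "- \<omega>"] sin_gt_mult_cos[of "- \<omega>"] \<omega>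
        by (auto simp: a_def b_def S_def C_def)
      then show ?thesis by (simp add: divide_neg_neg)
    qed
    then show "0 < a / S" "0 < b / S" by auto
  qed
  have a: "a \<noteq> 0" using pos by auto
  \<comment> \<open>With \<open>b\<close> and \<open>\<omega>\<close> written in \<open>a\<close>,
    \<open>S\<close> and \<open>C\<close>, the identities below become polynomial ones modulo
    \<open>SC\<close>, once multiplied by \<open>S\<^sup>2\<close>.\<close>
  have b_eq: "b = S^3 - C * a" using SC unfolding a_def b_def by algebra
  have \<omega>_eq: "\<omega> = a + S * C" by (simp add: a_def)
  have x_eq: "x * S\<^sup>2 = (s\<^sup>2 + 1) * a + 2 * s * b"
    using S by (simp add: x phiA_def phiB_def a_def b_def field_simps flip: S_def C_def)
  have trig: "2 * \<omega> - sin (2 * \<omega>) = 2 * a" "1 - cos (2 * \<omega>) = 2 * S\<^sup>2" "sin (2 * \<omega>) = 2 * S * C"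
    by (simp_all add: a_def S_def C_def sin_double cos_double_sin)
  define R where "R = 2 * ((a * s + b) / S)"
  have "4 * a * x + 4 * S\<^sup>2 - 4 * \<omega>\<^sup>2 = R\<^sup>2"
  proof -
    have "(4 * a * x + 4 * S\<^sup>2 - 4 * \<omega>\<^sup>2) * S\<^sup>2 = 4 * a * (x * S\<^sup>2) + 4 * S^4 - 4 * \<omega>\<^sup>2 * S\<^sup>2"
      by (simp add: algebra_simps power2_eq_square power4_eq_xxxx)
    also have "\<dots> = 4 * (a * s + b)\<^sup>2"
      unfolding x_eq b_eq \<omega>_eq using SC by algebra
    also have "\<dots> = R\<^sup>2 * S\<^sup>2" using S by (simp add: R_def field_simps power2_eq_square)
    finally show ?thesis using S by simp
  qed
  \<comment> \<open>The sign selects the branch: \<open>sqrt\<close> returns \<open>R\<close> and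
    not its negative.\<close>
  moreover have "0 \<le> R"
  proof -
    have "R = 2 * (a / S * s + b / S)" by (simp add: R_def add_divide_distrib)
    then show ?thesis using pos s by (metis add_nonneg_pos less_imp_le mult_nonneg_nonneg
          mult_pos_pos zero_less_numeral)
  qed
  ultimately have "sqrt (4 * a * x + 4 * S\<^sup>2 - 4 * \<omega>\<^sup>2) = R" by simp
  moreover have "2 * (2 * a) * x + 2 * (2 * S\<^sup>2) - (2 * \<omega>)\<^sup>2 = 4 * a * x + 4 * S\<^sup>2 - 4 * \<omega>\<^sup>2"
    by (simp add: power_mult_distrib)
  ultimately have root: "sqrt (2 * (2 * a) * x + 2 * (2 * S\<^sup>2) - (2 * \<omega>)\<^sup>2) = R" by simp
  have "LambdaH x (2 * \<omega>) = \<omega>\<^sup>2 / a\<^sup>2 * (2 * a * x + 4 * S\<^sup>2 - 4 * \<omega> * S * C - 2 * S\<^sup>2 * R)"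
    unfolding LambdaH_def trig(1,2) root by (simp add: trig(3) power_mult_distrib mult.assoc)
  also have "2 * a * x + 4 * S\<^sup>2 - 4 * \<omega> * S * C - 2 * S\<^sup>2 * R = 2 * a\<^sup>2 * (1 + ((s - C) / S)\<^sup>2)"
  proof -
    have "(2 * a * x + 4 * S\<^sup>2 - 4 * \<omega> * S * C - 2 * S\<^sup>2 * R) * S\<^sup>2
        = 2 * a * (x * S\<^sup>2) + 4 * S^4 - 4 * \<omega> * S^3 * C - 4 * S^3 * (a * s + b)"
      using S by (simp add: R_def field_simps power2_eq_square power3_eq_cube power4_eq_xxxx)
    also have "\<dots> = 2 * a\<^sup>2 * (S\<^sup>2 + (s - C)\<^sup>2)"
      unfolding x_eq b_eq \<omega>_eq using SC by algebra
    also have "\<dots> = 2 * a\<^sup>2 * (1 + ((s - C) / S)\<^sup>2) * S\<^sup>2"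
      using S by (simp add: power_divide field_simps)
    finally show ?thesis using S by simp
  qed
  finally show ?thesis using a by (simp add: S_def C_def)
qed

theorem theorem2p2:
  shows "(\<forall>\<theta> x v. -2*pi < \<theta> \<and> \<theta> < 2*pi \<and> \<theta> \<noteq> 0 \<and> (x, v) \<in> GammaH \<theta>
            \<longrightarrow> (1/2) * (dH (0, 1) (x, v))^2 = LambdaH x \<theta>)
       \<and> (\<forall>x v. (x, v) \<in> GammaH 0
            \<longrightarrow> x = 0 \<and> (1/2) * (dH (0, 1) (0, v))^2 = 2 * (sqrt v - 1)^2)"
proof (intro conjI allI impI)
  fix \<theta> x v :: real
  assume "-2*pi < \<theta> \<and> \<theta> < 2*pi \<and> \<theta> \<noteq> 0 \<and> (x, v) \<in> GammaH \<theta>"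
  then have \<theta>: "\<theta> \<noteq> 0" "\<bar>\<theta>\<bar> < 2 * pi" and v: "0 \<le> v" and "deltaH x v = \<theta>"
    by (auto simp: GammaH_def Hplane_def)
  then have "fH v \<theta> = x" using deltaH_spec(2)[OF v, of x] by simp
  define \<omega> where "\<omega> = \<theta> / 2"
  define s where "s = sqrt v"
  have \<omega>: "\<omega> \<noteq> 0" "\<bar>\<omega>\<bar> < pi" and \<theta>_eq: "\<theta> = 2 * \<omega>" using \<theta> by (auto simp: \<omega>_def)
  have s: "0 \<le> s" "s\<^sup>2 = v" using v by (auto simp: s_def)
  have S: "sin \<omega> \<noteq> 0" using \<omega> by (rule sin_neq_zero)
  have x: "x = (s\<^sup>2 + 1) * phiA \<omega> + 2 * s * phiB \<omega>"
    using \<open>fH v \<theta> = x\<close> s by (simp add: fH_eq_phi \<omega>_def s_def)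
  define E where "E = 4 * (\<omega>\<^sup>2 + (sqrt v * sin_ratio' \<omega> 0 - sin_ratio' \<omega> 1)\<^sup>2)"
  have ratio: "sin_ratio' \<omega> 0 = \<omega> / sin \<omega>" "sin_ratio' \<omega> 1 = \<omega> * cos \<omega> / sin \<omega>"
    using \<omega> by (auto simp: sin_ratio'_def)
  have E: "E = 4 * \<omega>\<^sup>2 * (1 + ((s - cos \<omega>) / sin \<omega>)\<^sup>2)"
  proof -
    have "s * (\<omega> / sin \<omega>) - \<omega> * cos \<omega> / sin \<omega> = \<omega> * ((s - cos \<omega>) / sin \<omega>)"
      using S by (simp add: field_simps)
    then show ?thesis
      unfolding E_def ratio s_def[symmetric] by (simp only: power_mult_distrib distrib_left mult_1_right mult.assoc)
  qed
  \<comment> \<open>This is where the formula for \<open>fH\<close> enters: at the angle solving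
    \<open>fH v \<theta> = x\<close>, the lower bound coincides with the squared speed.\<close>
  have "4 * \<omega> * x + 4 * ((v + 1) * sin_ratio' \<omega> 1 - 2 * sqrt v * sin_ratio' \<omega> 0) = E"
  proof -
    have "(4 * \<omega> * x + 4 * ((s\<^sup>2 + 1) * (\<omega> * cos \<omega> / sin \<omega>) - 2 * s * (\<omega> / sin \<omega>))) * (sin \<omega>)\<^sup>2
      = 4 * \<omega> * ((s\<^sup>2 + 1) * (\<omega> - sin \<omega> * cos \<omega>) + 2 * s * (sin \<omega> - \<omega> * cos \<omega>))
        + 4 * \<omega> * sin \<omega> * ((s\<^sup>2 + 1) * cos \<omega> - 2 * s)"
      unfolding x phiA_def phiB_def using S by (simp add: field_simps power2_eq_square)
    also have "\<dots> = 4 * \<omega>\<^sup>2 * ((sin \<omega>)\<^sup>2 + (s - cos \<omega>)\<^sup>2)"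
      using sin_cos_squared_add[of \<omega>] by algebra
    also have "\<dots> = E * (sin \<omega>)\<^sup>2" unfolding E using S by (simp add: power_divide field_simps)
    finally show ?thesis using S s ratio by (simp add: s_def)
  qed
  then have "dH (0, 1) (x, v) = sqrt E" using \<omega> v by (intro dH_eq[OF \<omega>(2) v E_def]) auto
  moreover have "0 \<le> E" unfolding E_def by simp
  ultimately show "(1/2) * (dH (0, 1) (x, v))^2 = LambdaH x \<theta>"
    using LambdaH_eq[OF \<omega> s(1) x] by (simp add: E \<theta>_eq)
next
  fix x v assume "(x, v) \<in> GammaH 0"
  then have v: "0 \<le> v" and "deltaH x v = 0" by (auto simp: GammaH_def Hplane_def)
  then show "x = 0" using deltaH_spec(2)[OF v, of x] by (simp add: fH_def)
  \<comment> \<open>At \<open>\<omega> = 0\<close> the oscillator is affine with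
    \<open>sin_ratio'\<close> equal to 1, so the minimiser is a vertical segment.\<close>
  have "dH (0, 1) (0, v) = sqrt (4 * (0\<^sup>2 + (sqrt v * sin_ratio' 0 0 - sin_ratio' 0 1)\<^sup>2))"
    by (rule dH_eq[OF _ v refl]) (use v in \<open>auto simp: sin_ratio'_def power2_eq_square algebra_simps\<close>)
  then show "(1/2) * (dH (0, 1) (0, v))^2 = 2 * (sqrt v - 1)^2"
    by (simp add: sin_ratio'_def)
qed

end
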